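(* Let $X$ be a separable metric space and let $S\subseteq\mathbb S$. (i) If $S$ is multiplicatively complete, then $\mathcal D_X(S)$ and $\overline{\mathcal D}_X(S)$ are $\sigma$-ideals of subsets of $X$ (closed under subsets and countable unions). (ii) If $S$ is countably determined, then $\mathcal D_X(S)$ is $G_\delta$-based, i.e., for each $S$-dominated set $E\subseteq X$ there is an $S$-dominated $G_\delta$-set $G\subseteq X$ with $G\supseteq E$.
   Context: $\mathbb S$ is the set of all strictly decreasing sequences $s=(s_n)_{n\geq1}$ of positive reals converging to $0$. For $s,s'\in\mathbb S$, $s\leq s'$ means $s_n\leq s'_n$ for all $n$. For $S,S'\subseteq\mathbb S$ write $S'\leq S$ if for every $s\in S$ there is $s'\in S'$ with $s'\leq s$; $S$ is countably determined if there is a countable $S'\subseteq\mathbb S$ with $S'\leq S$ and $S\leq S'$. $S$ is multiplicatively complete if for every $s\in S$ there is $s'\in S$ with $s'_n\leq s_{2n}$ for all $n\geq1$. A set $E\subseteq X$ is $S$-dominated if for each $s\in S$ there is a sequence $(E_n)_{n\geq1}$ of subsets of $X$ that covers $E$ and satisfies $\operatorname{diam}E_n<s_n$ for all $n\geq1$. $\mathcal D_X(S)$ is the family of all $S$-dominated subsets of $X$, and $\overline{\mathcal D}_X(S)$ is the family of all subsets of $X$ that are contained in a $\sigma$-compact $S$-dominated subset of $X$. *)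

theory Defs
  imports "HOL-Analysis.Analysis"
begin

text \<open>
  Sequences are indexed by \<open>n \<ge> 1\<close>; they are modelled as functions on \<^typ>\<open>nat\<close> whose value
  at \<open>0\<close> is arbitrary. No notion below depends on that value.
\<close>

definition null_seqs :: "(nat \<Rightarrow> real) set" where
  "null_seqs = {s. (\<forall>n\<ge>1. 0 < s n) \<and> strict_antimono_on {1..} s \<and> s \<longlonglongrightarrow> 0}"

definition seq_le :: "(nat \<Rightarrow> real) \<Rightarrow> (nat \<Rightarrow> real) \<Rightarrow> bool" where
  "seq_le s s' \<longleftrightarrow> (\<forall>n\<ge>1. s n \<le> s' n)"

definition seqs_le :: "(nat \<Rightarrow> real) set \<Rightarrow> (nat \<Rightarrow> real) set \<Rightarrow> bool" where
  "seqs_le S' S \<longleftrightarrow> (\<forall>s\<in>S. \<exists>s'\<in>S'. seq_le s' s)"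

definition countably_determined :: "(nat \<Rightarrow> real) set \<Rightarrow> bool" where
  "countably_determined S \<longleftrightarrow>
    (\<exists>S'. S' \<subseteq> null_seqs \<and> countable S' \<and> seqs_le S' S \<and> seqs_le S S')"

definition multiplicatively_complete :: "(nat \<Rightarrow> real) set \<Rightarrow> bool" where
  "multiplicatively_complete S \<longleftrightarrow> (\<forall>s\<in>S. \<exists>s'\<in>S. \<forall>n\<ge>1. s' n \<le> s (2 * n))"

text \<open>
  The diameter takes values in \<^typ>\<open>ennreal\<close>: it is \<open>\<infinity>\<close> for unbounded sets (where the
  real-valued \<^const>\<open>diameter\<close> is unspecified) and \<open>0\<close> for the empty set.
\<close>

definition ediam :: "'a metric \<Rightarrow> 'a set \<Rightarrow> ennreal" where
  "ediam X E = (SUP x\<in>E. SUP y\<in>E. ennreal (mdist X x y))"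

definition dominated_in :: "'a metric \<Rightarrow> (nat \<Rightarrow> real) set \<Rightarrow> 'a set \<Rightarrow> bool" where
  "dominated_in X S E \<longleftrightarrow> E \<subseteq> mspace X \<and>
    (\<forall>s\<in>S. \<exists>F :: nat \<Rightarrow> 'a set.
       (\<forall>n\<ge>1. F n \<subseteq> mspace X) \<and> E \<subseteq> (\<Union>n\<in>{1..}. F n) \<and>
       (\<forall>n\<ge>1. ediam X (F n) < ennreal (s n)))"

definition sigma_compact_in :: "'a topology \<Rightarrow> 'a set \<Rightarrow> bool" where
  "sigma_compact_in T = countable union_of compactin T"

definition dominated_family :: "'a metric \<Rightarrow> (nat \<Rightarrow> real) set \<Rightarrow> 'a set set" where
  "dominated_family X S = {E. dominated_in X S E}"

definition closed_dominated_family :: "'a metric \<Rightarrow> (nat \<Rightarrow> real) set \<Rightarrow> 'a set set" where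
  "closed_dominated_family X S =
    {E. \<exists>K. E \<subseteq> K \<and> sigma_compact_in (mtopology_of X) K \<and> dominated_in X S K}"

text \<open>The empty subfamily \<open>C = {}\<close> is allowed, so a \<open>\<sigma>\<close>-ideal contains the empty set.\<close>

definition sigma_ideal_on :: "'a set \<Rightarrow> 'a set set \<Rightarrow> bool" where
  "sigma_ideal_on M I \<longleftrightarrow> I \<subseteq> Pow M \<and>
    (\<forall>A\<in>I. \<forall>B. B \<subseteq> A \<longrightarrow> B \<in> I) \<and>
    (\<forall>C. C \<subseteq> I \<and> countable C \<longrightarrow> \<Union>C \<in> I)"

definition gdelta_based :: "'a topology \<Rightarrow> 'a set set \<Rightarrow> bool" where
  "gdelta_based T I \<longleftrightarrow> (\<forall>E\<in>I. \<exists>G\<in>I. gdelta_in T G \<and> E \<subseteq> G)"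

end

theory Submission
  imports Defs
begin

text \<open>
  Countable unions. Multiplicative completeness lets one replace a scale \<open>s \<in> S\<close> by a scale
  \<open>t\<^sub>k \<in> S\<close> with \<open>t\<^sub>k n \<le> s (2\<^sup>k n)\<close>, for any \<open>k\<close> (\<open>multiplicatively_complete_power\<close>). The
  numbers \<open>2\<^sup>k (2n - 1)\<close> with \<open>k \<ge> 0\<close> and \<open>n \<ge> 1\<close> are pairwise distinct (\<open>power_two_odd_inject\<close>),
  and \<open>2\<^sup>k (2n - 1) \<le> 2\<^bsup>k+1\<^esup> n\<close>. Hence, if the \<open>k\<close>-th set is covered at scale \<open>t\<^bsub>k+1\<^esub>\<close>, then,
  \<open>s\<close> being decreasing, its \<open>n\<close>-th piece is small enough to sit at position \<open>2\<^sup>k (2n - 1)\<close> of a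
  cover at scale \<open>s\<close>. No position is used twice, so all the covers merge into a single one
  (\<open>covered_at_scale_UN\<close>). For the second family one also uses that countable unions of
  \<open>\<sigma>\<close>-compact sets are \<open>\<sigma>\<close>-compact.

  \<open>G\<^sub>\<delta>\<close> hulls. The diameter bounds are strict, so each piece of a cover may be fattened to an open
  set that still obeys its bound; a set covered at scale \<open>s\<close> therefore lies in an open set covered
  at scale \<open>s\<close> (\<open>covered_at_scale_open_hull\<close>). Domination by \<open>S\<close> depends only on the class of \<open>S\<close>
  under mutual \<open>seqs_le\<close> (\<open>dominated_in_mono_scales\<close>), so countably many scales suffice, and the
  intersection of the corresponding open hulls is the required \<open>G\<^sub>\<delta>\<close> set.
\<close>

section \<open>Covers at a single scale\<close>

definition covered_at_scale :: "'a metric \<Rightarrow> (nat \<Rightarrow> real) \<Rightarrow> 'a set \<Rightarrow> bool" where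
  "covered_at_scale X s E \<longleftrightarrow> (\<exists>F :: nat \<Rightarrow> 'a set.
       (\<forall>n\<ge>1. F n \<subseteq> mspace X) \<and> E \<subseteq> (\<Union>n\<in>{1..}. F n) \<and>
       (\<forall>n\<ge>1. ediam X (F n) < ennreal (s n)))"

lemma dominated_in_iff_covered:
  "dominated_in X S E \<longleftrightarrow> E \<subseteq> mspace X \<and> (\<forall>s\<in>S. covered_at_scale X s E)"
  by (simp add: dominated_in_def covered_at_scale_def)

lemma covered_at_scaleE:
  assumes "covered_at_scale X s E"
  obtains F :: "nat \<Rightarrow> 'a set" where "\<And>n. n \<ge> 1 \<Longrightarrow> F n \<subseteq> mspace X"
    "E \<subseteq> (\<Union>n\<in>{1..}. F n)" "\<And>n. n \<ge> 1 \<Longrightarrow> ediam X (F n) < ennreal (s n)"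
  using assms unfolding covered_at_scale_def by blast

lemma covered_at_scale_subset:
  "covered_at_scale X s A \<Longrightarrow> B \<subseteq> A \<Longrightarrow> covered_at_scale X s B"
  unfolding covered_at_scale_def by (meson subset_trans)

lemma covered_at_scale_mono:
  assumes "covered_at_scale X s E" "seq_le s t"
  shows "covered_at_scale X t E"
proof -
  obtain F :: "nat \<Rightarrow> 'a set" where F: "\<And>n. n \<ge> 1 \<Longrightarrow> F n \<subseteq> mspace X"
    "E \<subseteq> (\<Union>n\<in>{1..}. F n)" "\<And>n. n \<ge> 1 \<Longrightarrow> ediam X (F n) < ennreal (s n)"
    using assms(1) by (rule covered_at_scaleE) blast
  have "ediam X (F n) < ennreal (t n)" if "n \<ge> 1" for n
    using F(3)[OF that] assms(2) that
    by (auto simp: seq_le_def intro: less_le_trans ennreal_leI)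
  with F show ?thesis unfolding covered_at_scale_def by blast
qed

lemma ediam_empty [simp]: "ediam X {} = 0"
  by (simp add: ediam_def bot_ennreal)

lemma covered_at_scale_empty:
  assumes "s \<in> null_seqs"
  shows "covered_at_scale X s {}"
  unfolding covered_at_scale_def
  using assms by (intro exI[of _ "\<lambda>_. {}"]) (auto simp: null_seqs_def ennreal_less_zero_iff)

lemma dominated_in_subset:
  "dominated_in X S A \<Longrightarrow> B \<subseteq> A \<Longrightarrow> dominated_in X S B"
  unfolding dominated_in_iff_covered by (meson covered_at_scale_subset subset_trans)

lemma dominated_in_mono_scales:
  assumes "dominated_in X S' E" "seqs_le S' S"
  shows "dominated_in X S E"
  using assms unfolding dominated_in_iff_covered seqs_le_def
  by (meson covered_at_scale_mono)

lemma dominated_in_empty: "S \<subseteq> null_seqs \<Longrightarrow> dominated_in X S {}"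
  by (auto simp: dominated_in_iff_covered intro: covered_at_scale_empty)

section \<open>Countable unions\<close>

lemma power_two_odd_inject:
  fixes m n k l :: nat
  assumes "odd m" "odd n" "2 ^ k * m = 2 ^ l * n"
  shows "k = l \<and> m = n"
  using assms(3)
proof (induction k arbitrary: l)
  case 0
  then show ?case using assms(1) by (cases l) auto
next
  case (Suc k)
  then show ?case using assms(2) by (cases l) auto
qed

text \<open>
  The \<open>n\<close>-th piece of the \<open>k\<close>-th cover goes to position \<open>2\<^sup>k (2n - 1)\<close>. These positions are
  pairwise distinct, so no two pieces are merged and each keeps its own diameter bound.
\<close>

lemma covered_at_scale_UN:
  fixes E :: "nat \<Rightarrow> 'a set"
  assumes s: "s \<in> null_seqs"
    and cov: "\<And>k. covered_at_scale X (t k) (E k)"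
    and le: "\<And>k n. n \<ge> 1 \<Longrightarrow> t k n \<le> s (2 ^ k * (2 * n - 1))"
  shows "covered_at_scale X s (\<Union>k. E k)"
proof -
  have "\<exists>F. \<forall>k. (\<forall>n\<ge>1. F k n \<subseteq> mspace X) \<and> E k \<subseteq> (\<Union>n\<in>{1..}. F k n) \<and>
       (\<forall>n\<ge>1. ediam X (F k n) < ennreal (t k n))"
    using cov unfolding covered_at_scale_def by (intro choice) blast
  then obtain F :: "nat \<Rightarrow> nat \<Rightarrow> 'a set" where F: "\<And>k n. n \<ge> 1 \<Longrightarrow> F k n \<subseteq> mspace X"
    "\<And>k. E k \<subseteq> (\<Union>n\<in>{1..}. F k n)" "\<And>k n. n \<ge> 1 \<Longrightarrow> ediam X (F k n) < ennreal (t k n)"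
    by blast
  define pos :: "nat \<Rightarrow> nat \<Rightarrow> nat" where "pos k n = 2 ^ k * (2 * n - 1)" for k n
  have inj: "k = l \<and> n = m" if "n \<ge> 1" "m \<ge> 1" "pos k n = pos l m" for k l n m
    using power_two_odd_inject[of "2*n-1" "2*m-1" k l] that by (auto simp: pos_def)
  have pos1: "pos k n \<ge> 1" if "n \<ge> 1" for k n
    using that by (simp add: pos_def Suc_le_eq)
  define G where "G m = \<Union>{F k n | k n. n \<ge> 1 \<and> pos k n = m}" for m
  have G_pos: "G (pos k n) = F k n" if "n \<ge> 1" for k n
    using that inj unfolding G_def by blast
  have diam: "ediam X (G m) < ennreal (s m)" if "m \<ge> 1" for m
  proof (cases "\<exists>k n. n \<ge> 1 \<and> pos k n = m")
    case True
    then obtain k n where kn: "n \<ge> 1" "pos k n = m" by blast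
    then have "ediam X (G m) < ennreal (t k n)" using F(3)[of n k] G_pos[of n k] by simp
    also have "\<dots> \<le> ennreal (s m)"
      using le[of n k] kn by (intro ennreal_leI) (auto simp: pos_def)
    finally show ?thesis .
  next
    case False
    then have "G m = {}" unfolding G_def by blast
    then show ?thesis using s that by (simp add: null_seqs_def ennreal_less_zero_iff)
  qed
  have "x \<in> (\<Union>m\<in>{1..}. G m)" if x: "x \<in> E k" for x k
  proof -
    obtain n where "n \<ge> 1" "x \<in> F k n" using subsetD[OF F(2) x] by auto
    then show ?thesis using G_pos[of n k] pos1[of n k] by (intro UN_I[of "pos k n"]) auto
  qed
  then have "(\<Union>k. E k) \<subseteq> (\<Union>m\<in>{1..}. G m)" by blast
  moreover have "G m \<subseteq> mspace X" for m using F(1) unfolding G_def by blast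
  ultimately show ?thesis
    using diam unfolding covered_at_scale_def by blast
qed

lemma multiplicatively_complete_power:
  assumes "multiplicatively_complete S" "s \<in> S"
  shows "\<exists>t\<in>S. \<forall>n\<ge>1. t n \<le> s (2 ^ k * n)"
proof (induction k)
  case 0
  then show ?case using assms(2) by (intro bexI[of _ s]) auto
next
  case (Suc k)
  then obtain t where t: "t \<in> S" "\<And>n. n \<ge> 1 \<Longrightarrow> t n \<le> s (2 ^ k * n)" by blast
  obtain u where u: "u \<in> S" "\<And>n. n \<ge> 1 \<Longrightarrow> u n \<le> t (2 * n)"
    using assms(1) t(1) unfolding multiplicatively_complete_def by blast
  have "u n \<le> s (2 ^ Suc k * n)" if "n \<ge> 1" for n
    using u(2)[OF that] t(2)[of "2 * n"] that by (simp add: mult_ac)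
  then show ?case using u(1) by blast
qed

lemma null_seqs_antimono:
  assumes "s \<in> null_seqs" "1 \<le> m" "m \<le> n"
  shows "s n \<le> s m"
proof (cases "m = n")
  case False
  then have "s n < s m"
    using assms by (auto simp: null_seqs_def monotone_on_def)
  then show ?thesis by simp
qed simp

lemma dominated_in_UN:
  fixes E :: "nat \<Rightarrow> 'a set"
  assumes S: "S \<subseteq> null_seqs" and mc: "multiplicatively_complete S"
    and E: "\<And>k. dominated_in X S (E k)"
  shows "dominated_in X S (\<Union>k. E k)"
  unfolding dominated_in_iff_covered
proof (intro conjI ballI)
  show "(\<Union>k. E k) \<subseteq> mspace X"
    using E by (auto simp: dominated_in_def)
next
  fix s assume s: "s \<in> S"
  have "\<exists>t. \<forall>k. t k \<in> S \<and> (\<forall>n\<ge>1. t k n \<le> s (2 ^ Suc k * n))"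
    using multiplicatively_complete_power[OF mc s] by (intro choice) blast
  then obtain t where t: "\<And>k. t k \<in> S" "\<And>k n. n \<ge> 1 \<Longrightarrow> t k n \<le> s (2 ^ Suc k * n)"
    by blast
  have sn: "s \<in> null_seqs" using s S by blast
  show "covered_at_scale X s (\<Union>k. E k)"
  proof (rule covered_at_scale_UN[OF sn])
    show "covered_at_scale X (t k) (E k)" for k
      using E t(1) by (auto simp: dominated_in_iff_covered)
    fix k n :: nat assume n: "n \<ge> 1"
    have "2 ^ k * (2 * n - 1) \<le> 2 ^ Suc k * n" "1 \<le> 2 ^ k * (2 * n - 1)"
      using n by (auto simp: Suc_le_eq algebra_simps)
    then have "s (2 ^ Suc k * n) \<le> s (2 ^ k * (2 * n - 1))"
      using null_seqs_antimono[OF sn] by blast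
    then show "t k n \<le> s (2 ^ k * (2 * n - 1))"
      using t(2)[OF n, of k] by linarith
  qed
qed

lemma dominated_in_Union:
  assumes S: "S \<subseteq> null_seqs" and mc: "multiplicatively_complete S"
    and C: "countable C" "\<And>E. E \<in> C \<Longrightarrow> dominated_in X S E"
  shows "dominated_in X S (\<Union>C)"
proof (cases "C = {}")
  case True
  then show ?thesis using dominated_in_empty[OF S] by simp
next
  case False
  have "dominated_in X S (\<Union>k. from_nat_into C k)"
    using C(2) from_nat_into[OF False] by (intro dominated_in_UN[OF S mc]) blast
  then show ?thesis using C(1) False by (simp add: range_from_nat_into)
qed

lemma sigma_ideal_dominated_family:
  assumes "S \<subseteq> null_seqs" "multiplicatively_complete S"
  shows "sigma_ideal_on (mspace X) (dominated_family X S)"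
  unfolding sigma_ideal_on_def
proof (intro conjI ballI allI impI)
  show "dominated_family X S \<subseteq> Pow (mspace X)"
    by (auto simp: dominated_family_def dominated_in_def)
  show "B \<in> dominated_family X S" if "A \<in> dominated_family X S" "B \<subseteq> A" for A B
    using that dominated_in_subset by (auto simp: dominated_family_def)
  show "\<Union>C \<in> dominated_family X S" if "C \<subseteq> dominated_family X S \<and> countable C" for C
    using that dominated_in_Union[OF assms, of C X] by (auto simp: dominated_family_def)
qed

lemma sigma_ideal_closed_dominated_family:
  assumes "S \<subseteq> null_seqs" "multiplicatively_complete S"
  shows "sigma_ideal_on (mspace X) (closed_dominated_family X S)"
  unfolding sigma_ideal_on_def
proof (intro conjI ballI allI impI)
  show "closed_dominated_family X S \<subseteq> Pow (mspace X)"
    by (auto simp: closed_dominated_family_def dominated_in_def)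
  show "B \<in> closed_dominated_family X S" if "A \<in> closed_dominated_family X S" "B \<subseteq> A" for A B
    using that unfolding closed_dominated_family_def by blast
  fix C assume C: "C \<subseteq> closed_dominated_family X S \<and> countable C"
  then have "\<forall>E\<in>C. \<exists>K. E \<subseteq> K \<and> sigma_compact_in (mtopology_of X) K \<and> dominated_in X S K"
    by (auto simp: closed_dominated_family_def)
  then obtain K where K: "\<And>E. E \<in> C \<Longrightarrow> E \<subseteq> K E"
    "\<And>E. E \<in> C \<Longrightarrow> sigma_compact_in (mtopology_of X) (K E)"
    "\<And>E. E \<in> C \<Longrightarrow> dominated_in X S (K E)"
    by metis
  have "dominated_in X S (\<Union>(K ` C))"
    using C K(3) by (intro dominated_in_Union[OF assms]) auto
  moreover have "sigma_compact_in (mtopology_of X) (\<Union>(K ` C))"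
    using C K(2) unfolding sigma_compact_in_def by (intro countable_union_of_Union) auto
  moreover have "\<Union>C \<subseteq> \<Union>(K ` C)" using K(1) by blast
  ultimately show "\<Union>C \<in> closed_dominated_family X S"
    unfolding closed_dominated_family_def by blast
qed

section \<open>Open hulls and \<open>G\<^sub>\<delta>\<close> hulls\<close>

lemma mdist_le_ediam:
  assumes "x \<in> F" "y \<in> F"
  shows "ennreal (mdist X x y) \<le> ediam X F"
  unfolding ediam_def by (rule SUP_upper2[OF assms(1)], rule SUP_upper[OF assms(2)])

text \<open>
  If all distances in \<open>F\<close> are at most \<open>d < r\<close>, then those in the \<open>e\<close>-neighbourhood of \<open>F\<close> are at
  most \<open>d + 2e\<close>, which is still below \<open>r\<close> for \<open>e = (r - d)/3\<close>.
\<close>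

lemma open_superset_ediam_less:
  assumes F: "F \<subseteq> mspace X" and r: "ediam X F < ennreal r"
  obtains U where "openin (mtopology_of X) U" "F \<subseteq> U" "ediam X U < ennreal r"
proof -
  interpret Metric_space "mspace X" "mdist X" by simp
  define d where "d = enn2real (ediam X F)"
  have d0: "d \<ge> 0" by (simp add: d_def)
  have ediam: "ediam X F = ennreal d"
    using r unfolding d_def by (metis ennreal_enn2real ennreal_less_top order_less_trans)
  then have dr: "d < r" using r d0 by (simp add: ennreal_less_iff)
  define e where "e = (r - d) / 3"
  have e: "e > 0" "d + 2 * e < r" using dr by (auto simp: e_def field_simps)
  define U where "U = (\<Union>x\<in>F. mball x e)"
  have "openin (mtopology_of X) U"
    unfolding U_def mtopology_of_def by (intro openin_Union) auto
  moreover have "F \<subseteq> U"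
    using F e(1) unfolding U_def by (auto intro!: bexI)
  moreover have "ediam X U < ennreal r"
  proof -
    have "mdist X x y \<le> d + 2 * e" if xy: "x \<in> U" "y \<in> U" for x y
    proof -
      obtain a b where a: "a \<in> F" "x \<in> mspace X" "mdist X a x < e"
        and b: "b \<in> F" "y \<in> mspace X" "mdist X b y < e"
        using xy unfolding U_def by auto
      have "a \<in> mspace X" "b \<in> mspace X" using a b F by auto
      then have "mdist X x y \<le> mdist X x a + mdist X a b + mdist X b y"
        using mdist_triangle[of x X a y] mdist_triangle[of a X b y] a(2) b(2) by linarith
      moreover have "mdist X a b \<le> d"
        using mdist_le_ediam[OF a(1) b(1), of X] d0 by (simp add: ediam)
      ultimately show ?thesis
        using a(3) b(3) mdist_commute[of X x a] by linarith
    qed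
    then have "ediam X U \<le> ennreal (d + 2 * e)"
      unfolding ediam_def by (intro SUP_least ennreal_leI)
    also have "\<dots> < ennreal r" using e d0 by (intro ennreal_lessI) auto
    finally show ?thesis .
  qed
  ultimately show ?thesis using that by blast
qed

lemma covered_at_scale_open_hull:
  assumes "covered_at_scale X s E"
  obtains V where "openin (mtopology_of X) V" "E \<subseteq> V" "covered_at_scale X s V"
proof -
  obtain F :: "nat \<Rightarrow> 'a set" where F: "\<And>n. n \<ge> 1 \<Longrightarrow> F n \<subseteq> mspace X"
    "E \<subseteq> (\<Union>n\<in>{1..}. F n)" "\<And>n. n \<ge> 1 \<Longrightarrow> ediam X (F n) < ennreal (s n)"
    using assms by (rule covered_at_scaleE) blast
  have "\<forall>n\<in>{1..}. \<exists>U. openin (mtopology_of X) U \<and> F n \<subseteq> U \<and> ediam X U < ennreal (s n)"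
    using open_superset_ediam_less[OF F(1) F(3)] by (metis atLeast_iff)
  then obtain U where U: "\<And>n. n \<ge> 1 \<Longrightarrow> openin (mtopology_of X) (U n)"
    "\<And>n. n \<ge> 1 \<Longrightarrow> F n \<subseteq> U n" "\<And>n. n \<ge> 1 \<Longrightarrow> ediam X (U n) < ennreal (s n)"
    by (metis atLeast_iff)
  show ?thesis
  proof
    show "openin (mtopology_of X) (\<Union>n\<in>{1..}. U n)" using U(1) by (intro openin_Union) auto
    show "E \<subseteq> (\<Union>n\<in>{1..}. U n)" using F(2) U(2) by fastforce
    have "U n \<subseteq> mspace X" if "n \<ge> 1" for n
      using openin_subset[OF U(1)[OF that]] by simp
    then show "covered_at_scale X s (\<Union>n\<in>{1..}. U n)"
      using U(3) unfolding covered_at_scale_def by blast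
  qed
qed

lemma gdelta_based_dominated_family:
  assumes "countably_determined S"
  shows "gdelta_based (mtopology_of X) (dominated_family X S)"
  unfolding gdelta_based_def
proof
  fix E assume "E \<in> dominated_family X S"
  then have E: "dominated_in X S E" by (simp add: dominated_family_def)
  obtain S' where S': "countable S'" "seqs_le S' S" "seqs_le S S'"
    using assms by (auto simp: countably_determined_def)
  have E': "E \<subseteq> mspace X" "\<And>s. s \<in> S' \<Longrightarrow> covered_at_scale X s E"
    using dominated_in_mono_scales[OF E S'(3)] by (auto simp: dominated_in_iff_covered)
  have "\<forall>s\<in>S'. \<exists>V. openin (mtopology_of X) V \<and> E \<subseteq> V \<and> covered_at_scale X s V"
    using covered_at_scale_open_hull[OF E'(2)] by metis
  then obtain V where V: "\<And>s. s \<in> S' \<Longrightarrow> openin (mtopology_of X) (V s)"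
    "\<And>s. s \<in> S' \<Longrightarrow> E \<subseteq> V s" "\<And>s. s \<in> S' \<Longrightarrow> covered_at_scale X s (V s)"
    by metis
  \<comment> \<open>The whole space is added to the family so that the intersection stays inside it when
      \<open>S'\<close> is empty.\<close>
  define G where "G = \<Inter>(insert (mspace X) (V ` S'))"
  have "openin (mtopology_of X) (mspace X)"
    using openin_topspace[of "mtopology_of X"] by simp
  then have "gdelta_in (mtopology_of X) G"
    unfolding G_def using S'(1) V(1)
    by (intro gdelta_in_Inter) (auto intro: open_imp_gdelta_in)
  moreover have "E \<subseteq> G" using E'(1) V(2) unfolding G_def by blast
  moreover have "dominated_in X S' G"
    unfolding dominated_in_iff_covered
  proof (intro conjI ballI)
    show "G \<subseteq> mspace X" by (auto simp: G_def)
    show "covered_at_scale X s G" if "s \<in> S'" for s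
      by (rule covered_at_scale_subset[OF V(3)[OF that]]) (use that in \<open>auto simp: G_def\<close>)
  qed
  then have "G \<in> dominated_family X S"
    using dominated_in_mono_scales[OF _ S'(2)] by (simp add: dominated_family_def)
  ultimately show "\<exists>G\<in>dominated_family X S. gdelta_in (mtopology_of X) G \<and> E \<subseteq> G"
    by blast
qed

theorem theorem2p4:
  fixes X :: "'a metric" and S :: "(nat \<Rightarrow> real) set"
  assumes "separable_space (mtopology_of X)"
    and "S \<subseteq> null_seqs"
  shows "(multiplicatively_complete S \<longrightarrow>
            sigma_ideal_on (mspace X) (dominated_family X S) \<and>
            sigma_ideal_on (mspace X) (closed_dominated_family X S)) \<and>
         (countably_determined S \<longrightarrow>
            gdelta_based (mtopology_of X) (dominated_family X S))"
  using sigma_ideal_dominated_family[OF assms(2)] sigma_ideal_closed_dominated_family[OF assms(2)]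
    gdelta_based_dominated_family by blast

end
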